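(* For any method employing the update $$v_{k+1}=v_k-a_{k+1}B^{-1}\nabla f(y_{k+1}),\qquad k\ge0,$$ (no estimate sequence property being required), we have for all $k\ge0$ that $$\mathcal{D}_k\ge\mathcal{D}_{k+1}+\left(\frac{A_{k+1}}{L_f}-\frac{a_{k+1}^2}{2}\right)\|\nabla f(y_{k+1})\|_*^2+\left\langle\nabla f(y_{k+1}),A_k\left(y_k-\frac{1}{L_f}B^{-1}\nabla f(y_k)\right)+a_{k+1}v_k-A_{k+1}y_{k+1}\right\rangle .$$
   Context: $\mathbb{E}$ is an $n$-dimensional real vector space, $\mathbb{E}^*$ its dual, $\langle s,x\rangle$ the value of $s\in\mathbb{E}^*$ at $x\in\mathbb{E}$. $B:\mathbb{E}\to\mathbb{E}^*$ is a symmetric positive definite linear operator, $\|x\|=\sqrt{\langle Bx,x\rangle}$ on $\mathbb{E}$ and $\|g\|_*=\sqrt{\langle g,B^{-1}g\rangle}$ on $\mathbb{E}^*$. $f:\mathbb{E}\to\mathbb{R}$ is convex and differentiable, with gradient Lipschitz continuous with constant $L_f>0$ (i.e. $\|\nabla f(x)-\nabla f(y)\|_*\le L_f\|x-y\|$). The set $X^*$ of minimizers of $f$ is non-empty and $x^*\in X^*$ is fixed. The method has starting point $x_0\in\mathbb{E}$, auxiliary points $y_k\in\mathbb{E}$ ($y_0=x_0$), points $v_k\in\mathbb{E}$ ($v_0=x_0$) and weights $a_{k+1}>0$, with $A_0=0$ and $A_{k+1}=A_k+a_{k+1}$. The gap terms are $$\mathcal{D}_k=A_k\left(f(y_k)-\frac{1}{2L_f}\|\nabla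 f(y_k)\|_*^2-f(x^* )\right)+\frac12\|v_k-x^*\|^2,\qquad k\ge0.$$ *)

theory Defs
  imports "HOL-Analysis.Analysis"
begin

text \<open>The space is a type of class \<open>euclidean_space\<close>, and its dual is the type of bounded linear
  functionals on it: on a finite-dimensional space these are all the linear functionals. The inner
  product of the class plays no role; only its topology is used, for differentiability, and this
  does not depend on the choice of the norm.\<close>

abbreviation dual_pairing :: "('a::euclidean_space \<Rightarrow>\<^sub>L real) \<Rightarrow> 'a \<Rightarrow> real"
    ("\<langle>_,/ _\<rangle>")
  where "\<langle>s, x\<rangle> \<equiv> blinfun_apply s x"

definition spd_operator :: "('a::euclidean_space \<Rightarrow> ('a \<Rightarrow>\<^sub>L real)) \<Rightarrow> bool"
  where "spd_operator B \<longleftrightarrow>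
    linear B \<and> (\<forall>x y. \<langle>B x, y\<rangle> = \<langle>B y, x\<rangle>) \<and> (\<forall>x. x \<noteq> 0 \<longrightarrow> \<langle>B x, x\<rangle> > 0)"

definition primal_norm :: "('a::euclidean_space \<Rightarrow> ('a \<Rightarrow>\<^sub>L real)) \<Rightarrow> 'a \<Rightarrow> real"
  where "primal_norm B x = sqrt \<langle>B x, x\<rangle>"

text \<open>Here \<open>inv B\<close> is the inverse of \<open>B\<close>, which is bijective when it is
  symmetric positive definite: see \<open>spd_operator_bij\<close> below.\<close>

definition dual_norm :: "('a::euclidean_space \<Rightarrow> ('a \<Rightarrow>\<^sub>L real)) \<Rightarrow> ('a \<Rightarrow>\<^sub>L real) \<Rightarrow> real"
  where "dual_norm B g = sqrt \<langle>g, inv B g\<rangle>"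

text \<open>The gradient is an element of the dual space, namely the Frechet derivative. It is
  meaningful where \<open>f\<close> is differentiable: see \<open>gradient_has_derivative\<close> below.\<close>

definition gradient :: "('a::euclidean_space \<Rightarrow> real) \<Rightarrow> 'a \<Rightarrow> ('a \<Rightarrow>\<^sub>L real)"
  where "gradient f x = Blinfun (frechet_derivative f (at x))"

definition minimizers :: "('a \<Rightarrow> real) \<Rightarrow> 'a set"
  where "minimizers f = {x. is_arg_min f (\<lambda>_. True) x}"

definition gap_term ::
    "('a::euclidean_space \<Rightarrow> ('a \<Rightarrow>\<^sub>L real)) \<Rightarrow> ('a \<Rightarrow> real) \<Rightarrow> real \<Rightarrow> 'a
      \<Rightarrow> (nat \<Rightarrow> real) \<Rightarrow> (nat \<Rightarrow> 'a) \<Rightarrow> (nat \<Rightarrow> 'a) \<Rightarrow> nat \<Rightarrow> real"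
  where "gap_term B f L xstar A y v k =
    A k * (f (y k) - 1 / (2 * L) * (dual_norm B (gradient f (y k)))\<^sup>2 - f xstar)
      + 1 / 2 * (primal_norm B (v k - xstar))\<^sup>2"

lemma spd_operator_bij:
  fixes B :: "'a::euclidean_space \<Rightarrow> ('a \<Rightarrow>\<^sub>L real)"
  assumes "spd_operator B"
  shows "bij B"
proof -
  have lin: "linear B" and pos: "\<And>x. x \<noteq> 0 \<Longrightarrow> \<langle>B x, x\<rangle> > 0"
    using assms by (auto simp: spd_operator_def)
  have ker: "x = 0" if "B x = 0" for x
    using pos[of x] that by (cases "x = 0") auto
  define R :: "('a \<Rightarrow>\<^sub>L real) \<Rightarrow> 'a" where "R g = (\<Sum>b\<in>Basis. \<langle>g, b\<rangle> *\<^sub>R b)" for g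
  have linR: "linear R"
    by (rule linearI)
      (simp_all add: R_def blinfun.add_left blinfun.scaleR_left scaleR_add_left sum.distrib
        scaleR_sum_right)
  have R0: "g = 0" if "R g = 0" for g
  proof (rule blinfun_euclidean_eqI)
    fix b :: 'a assume b: "b \<in> Basis"
    have "R g \<bullet> b = \<langle>g, b\<rangle>"
      using b by (simp add: R_def)
    then show "\<langle>g, b\<rangle> = \<langle>0, b\<rangle>" using that by simp
  qed
  have injR: "inj R" using linR R0 by (simp add: linear_injective_0)
  have injB: "inj B" using lin ker by (simp add: linear_injective_0)
  have "linear (R \<circ> B)" "inj (R \<circ> B)"
    using lin linR injR injB by (auto intro: linear_compose inj_compose)
  then have s: "surj (R \<circ> B)" by (rule linear_inj_imp_surj)
  have "surj B"
  proof (rule surjI)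
    fix g show "B (inv (R \<circ> B) (R g)) = g"
      using surj_f_inv_f[OF s, of "R g"] injR by (simp add: inj_eq)
  qed
  with injB show ?thesis by (simp add: bij_def)
qed

lemma gradient_has_derivative:
  fixes f :: "'a::euclidean_space \<Rightarrow> real"
  assumes "f differentiable (at x)"
  shows "(f has_derivative blinfun_apply (gradient f x)) (at x)"
  using assms
  by (simp add: gradient_def frechet_derivative_works bounded_linear_Blinfun_apply
      has_derivative_bounded_linear)

end

theory Submission
  imports Defs
begin

text \<open>For a convex \<open>f\<close> with \<open>L\<close>-Lipschitz gradient, the function
  \<open>w \<mapsto> f w - \<langle>\<nabla>f(z), w\<rangle>\<close> is minimal at \<open>z\<close>, and a gradient step of length \<open>1/L\<close> from \<open>x\<close>
  decreases it by at least \<open>\<parallel>\<nabla>f(x) - \<nabla>f(z)\<parallel>\<^sub>*\<^sup>2 / (2L)\<close>; hence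
  \<open>f x \<ge> f z + \<langle>\<nabla>f(z), x - z\<rangle> + \<parallel>\<nabla>f(x) - \<nabla>f(z)\<parallel>\<^sub>*\<^sup>2 / (2L)\<close>.
  With \<open>z = y\<^sub>k\<^sub>+\<^sub>1\<close>, add \<open>A\<^sub>k\<close> times this inequality at \<open>x = y\<^sub>k\<close> and \<open>a\<^sub>k\<^sub>+\<^sub>1\<close> times the one at
  \<open>x = x\<^sup>*\<close>, where the gradient vanishes. After expanding the square \<open>\<parallel>v\<^sub>k\<^sub>+\<^sub>1 - x\<^sup>*\<parallel>\<^sup>2\<close>
  this is exactly the claim.\<close>

lemma spd_operator_inv [simp]:
  assumes "spd_operator B"
  shows "B (inv B g) = g"
  by (meson assms bij_inv_eq_iff spd_operator_bij)

lemma spd_operator_nonneg: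
  assumes "spd_operator B"
  shows "0 \<le> \<langle>B x, x\<rangle>"
  using assms by (cases "x = 0") (auto simp: spd_operator_def less_imp_le)

lemma spd_operator_sym:
  assumes "spd_operator B"
  shows "\<langle>B x, z\<rangle> = \<langle>B z, x\<rangle>"
  using assms by (simp add: spd_operator_def)

lemma spd_operator_linear:
  assumes "spd_operator B"
  shows "linear B"
  using assms by (simp add: spd_operator_def)

lemma spd_operator_inv_linear:
  assumes "spd_operator B"
  shows "linear (inv B)"
proof -
  note lin = spd_operator_linear[OF assms]
  have inj: "inj B" using spd_operator_bij[OF assms] by (simp add: bij_def)
  show ?thesis
    \<comment> \<open>Since \<open>B\<close> is injective, both linearity laws may be checked after
      applying it, where \<open>B (inv B g) = g\<close> removes the inverses.\<close>
    by (rule linearI; rule injD[OF inj])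
      (simp_all add: assms linear_add[OF lin] linear_scale[OF lin])
qed

lemma primal_norm_nonneg:
  assumes "spd_operator B"
  shows "0 \<le> primal_norm B x"
  by (simp add: primal_norm_def spd_operator_nonneg[OF assms])

lemma primal_norm_sq:
  assumes "spd_operator B"
  shows "(primal_norm B x)\<^sup>2 = \<langle>B x, x\<rangle>"
  by (simp add: primal_norm_def spd_operator_nonneg[OF assms])

text \<open>\<open>inv B\<close> is an isometry from the dual to the primal space, so identities for
  the primal norm carry over to the dual one.\<close>

lemma dual_norm_eq_primal_norm:
  assumes "spd_operator B"
  shows "dual_norm B g = primal_norm B (inv B g)"
  by (simp add: dual_norm_def primal_norm_def assms)

lemma dual_norm_sq:
  assumes "spd_operator B"
  shows "(dual_norm B g)\<^sup>2 = \<langle>g, inv B g\<rangle>"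
  by (simp add: dual_norm_eq_primal_norm primal_norm_sq assms)

lemma primal_norm_diff_sq:
  assumes "spd_operator B"
  shows "(primal_norm B (x - z))\<^sup>2 = (primal_norm B x)\<^sup>2 - 2 * \<langle>B z, x\<rangle> + (primal_norm B z)\<^sup>2"
  using spd_operator_sym[OF assms, of x z]
  by (simp add: primal_norm_sq assms linear_diff[OF spd_operator_linear[OF assms]]
      blinfun.diff_left blinfun.diff_right)

lemma dual_norm_diff_sq:
  assumes "spd_operator B"
  shows "(dual_norm B (g - h))\<^sup>2 = (dual_norm B g)\<^sup>2 - 2 * \<langle>h, inv B g\<rangle> + (dual_norm B h)\<^sup>2"
  by (simp add: dual_norm_eq_primal_norm assms linear_diff[OF spd_operator_inv_linear[OF assms]]
      primal_norm_diff_sq)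

lemma primal_norm_scaleR:
  assumes "spd_operator B"
  shows "primal_norm B (c *\<^sub>R x) = \<bar>c\<bar> * primal_norm B x"
  by (simp add: primal_norm_def linear_scale[OF spd_operator_linear[OF assms]]
      blinfun.scaleR_left blinfun.scaleR_right real_sqrt_mult flip: mult.assoc)

text \<open>This is Cauchy-Schwarz for the inner product induced by \<open>B\<close>, applied to
  \<open>inv B s\<close> and \<open>d\<close>.\<close>

lemma dual_pairing_le:
  assumes B: "spd_operator B"
  shows "\<langle>s, d\<rangle> \<le> dual_norm B s * primal_norm B d"
proof (cases "d = 0")
  case False
  define q r where "q = \<langle>B d, d\<rangle>" and "r = \<langle>s, d\<rangle>"
  have q: "q > 0" using B False by (simp add: spd_operator_def q_def)
  note lin = spd_operator_linear[OF B]
  have "\<langle>B d, inv B s\<rangle> = r"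
    using spd_operator_sym[OF B, of d "inv B s"] by (simp add: B r_def)
  \<comment> \<open>The vector is \<open>q\<close> times the component of \<open>inv B s\<close>
    that is \<open>B\<close>-orthogonal to \<open>d\<close>; the scaling by \<open>q\<close> avoids
    a division.\<close>
  then have "\<langle>B (q *\<^sub>R inv B s - r *\<^sub>R d), q *\<^sub>R inv B s - r *\<^sub>R d\<rangle>
      = q * (q * \<langle>s, inv B s\<rangle> - r\<^sup>2)"
    by (simp add: linear_diff[OF lin] linear_scale[OF lin] B blinfun.diff_left blinfun.diff_right
        blinfun.scaleR_left blinfun.scaleR_right power2_eq_square algebra_simps
        flip: q_def r_def)
  then have "0 \<le> q * (q * \<langle>s, inv B s\<rangle> - r\<^sup>2)"
    using spd_operator_nonneg[OF B] by metis
  then have "r\<^sup>2 \<le> \<langle>s, inv B s\<rangle> * q"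
    using q by (simp add: zero_le_mult_iff mult.commute)
  then have "r \<le> sqrt (\<langle>s, inv B s\<rangle> * q)"
    by (rule real_le_rsqrt)
  then show ?thesis
    by (simp add: dual_norm_def primal_norm_def q_def r_def real_sqrt_mult)
qed (simp add: primal_norm_def)

lemma has_real_derivative_along_line:
  fixes f :: "'a::euclidean_space \<Rightarrow> real"
  assumes "\<And>x. f differentiable (at x)"
  shows "((\<lambda>t. f (x + t *\<^sub>R d)) has_real_derivative \<langle>gradient f (x + t *\<^sub>R d), d\<rangle>) (at t within S)"
proof -
  have "((\<lambda>t. f (x + t *\<^sub>R d)) has_derivative
      (\<lambda>h. \<langle>gradient f (x + t *\<^sub>R d), h *\<^sub>R d\<rangle>)) (at t within S)"
    by (rule has_derivative_compose[OF _ gradient_has_derivative[OF assms]])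
      (auto intro!: derivative_eq_intros)
  then show ?thesis
    by (simp add: has_field_derivative_def blinfun.scaleR_right mult.commute[of _ "\<langle>_, _\<rangle>"])
qed

text \<open>On the line through \<open>z\<close> and \<open>x\<close> this is the one-dimensional
  tangent inequality, with the tangent taken at \<open>t = 0\<close> and evaluated at
  \<open>t = 1\<close>.\<close>

lemma convex_on_above_gradient:
  fixes f :: "'a::euclidean_space \<Rightarrow> real"
  assumes "convex_on UNIV f" and "\<And>x. f differentiable (at x)"
  shows "f x \<ge> f z + \<langle>gradient f z, x - z\<rangle>"
proof -
  have "convex_on UNIV (\<lambda>t::real. f (z + t *\<^sub>R (x - z)))"
  proof (rule convex_onI)
    fix t r s :: real
    assume "0 < t" "t < 1"
    then have "f ((1 - t) *\<^sub>R (z + r *\<^sub>R (x - z)) + t *\<^sub>R (z + s *\<^sub>R (x - z)))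
        \<le> (1 - t) * f (z + r *\<^sub>R (x - z)) + t * f (z + s *\<^sub>R (x - z))"
      by (intro convex_onD[OF assms(1)]) auto
    then show "f (z + ((1 - t) *\<^sub>R r + t *\<^sub>R s) *\<^sub>R (x - z))
        \<le> (1 - t) * f (z + r *\<^sub>R (x - z)) + t * f (z + s *\<^sub>R (x - z))"
      by (simp add: algebra_simps)
  qed simp
  from convex_on_imp_above_tangent[OF this _ _ _
      has_real_derivative_along_line[OF assms(2), where t = 0 and S = UNIV], of 1]
  show ?thesis by simp
qed

lemma descent_lemma:
  fixes f :: "'a::euclidean_space \<Rightarrow> real"
  assumes B: "spd_operator B"
    and diff: "\<And>x. f differentiable (at x)"
    and lip: "\<And>x z. dual_norm B (gradient f x - gradient f z) \<le> L * primal_norm B (x - z)"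
  shows "f (x + d) \<le> f x + \<langle>gradient f x, d\<rangle> + L / 2 * (primal_norm B d)\<^sup>2"
proof -
  define \<psi> where
    "\<psi> t = f (x + t *\<^sub>R d) - t * \<langle>gradient f x, d\<rangle> - L / 2 * t\<^sup>2 * (primal_norm B d)\<^sup>2" for t
  define \<psi>' where
    "\<psi>' t = \<langle>gradient f (x + t *\<^sub>R d) - gradient f x, d\<rangle> - L * t * (primal_norm B d)\<^sup>2" for t
  have "\<psi> 1 \<le> \<psi> 0"
  proof (rule DERIV_nonpos_imp_nonincreasing[where f = \<psi>])
    fix t :: real
    assume "0 \<le> t" "t \<le> 1"
    have "(\<psi> has_real_derivative \<psi>' t) (at t)"
      unfolding \<psi>_def \<psi>'_def
      by (rule derivative_eq_intros has_real_derivative_along_line[OF diff] refl)+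
        (simp add: blinfun.diff_left)
    moreover have "\<psi>' t \<le> 0"
    proof -
      have "\<langle>gradient f (x + t *\<^sub>R d) - gradient f x, d\<rangle>
          \<le> dual_norm B (gradient f (x + t *\<^sub>R d) - gradient f x) * primal_norm B d"
        by (rule dual_pairing_le[OF B])
      also have "\<dots> \<le> (L * (t * primal_norm B d)) * primal_norm B d"
        using lip[of "x + t *\<^sub>R d" x] \<open>0 \<le> t\<close>
        by (intro mult_right_mono) (simp_all add: primal_norm_scaleR[OF B] primal_norm_nonneg[OF B])
      finally show ?thesis by (simp add: \<psi>'_def power2_eq_square mult.assoc)
    qed
    ultimately show "\<exists>D. (\<psi> has_real_derivative D) (at t) \<and> D \<le> 0"
      by blast
  qed simp
  then show ?thesis by (simp add: \<psi>_def)
qed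

lemma convex_smooth_lower_bound:
  fixes f :: "'a::euclidean_space \<Rightarrow> real"
  assumes B: "spd_operator B"
    and "convex_on UNIV f"
    and diff: "\<And>x. f differentiable (at x)"
    and L: "L > 0"
    and lip: "\<And>x z. dual_norm B (gradient f x - gradient f z) \<le> L * primal_norm B (x - z)"
  shows "f x \<ge> f z + \<langle>gradient f z, x - z\<rangle>
    + 1 / (2 * L) * (dual_norm B (gradient f x - gradient f z))\<^sup>2"
proof -
  define h where "h = gradient f x - gradient f z"
  \<comment> \<open>This \<open>d\<close> minimizes
    \<open>\<langle>h, d\<rangle> + L / 2 * (primal_norm B d)\<^sup>2\<close>, with minimum
    \<open>- (dual_norm B h)\<^sup>2 / (2 * L)\<close>. The value \<open>f (x + d)\<close> is then
    squeezed between the tangent at \<open>z\<close> and the quadratic model at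
    \<open>x\<close>.\<close>
  define d where "d = - (1 / L) *\<^sub>R inv B h"
  have "f z + \<langle>gradient f z, (x + d) - z\<rangle> \<le> f (x + d)"
    by (rule convex_on_above_gradient) fact+
  also have "\<dots> \<le> f x + \<langle>gradient f x, d\<rangle> + L / 2 * (primal_norm B d)\<^sup>2"
    by (rule descent_lemma[OF B diff lip])
  also have "\<langle>gradient f x, d\<rangle> = \<langle>gradient f z, d\<rangle> + \<langle>h, d\<rangle>"
    by (simp add: h_def blinfun.diff_left)
  also have "\<langle>h, d\<rangle> = - (1 / L) * (dual_norm B h)\<^sup>2"
    by (simp only: d_def dual_norm_sq[OF B] blinfun.scaleR_right real_scaleR_def)
  also have "(primal_norm B d)\<^sup>2 = (dual_norm B h)\<^sup>2 / L\<^sup>2"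
    by (simp only: d_def primal_norm_scaleR[OF B] dual_norm_eq_primal_norm[OF B] power_mult_distrib)
      (simp add: power_divide)
  finally show ?thesis
    using L by (simp add: blinfun.add_right blinfun.diff_right power2_eq_square field_simps
        flip: h_def)
qed

lemma gradient_minimizer:
  fixes f :: "'a::euclidean_space \<Rightarrow> real"
  assumes "\<And>x. f differentiable (at x)" and "z \<in> minimizers f"
  shows "gradient f z = 0"
proof -
  have "f z \<le> f w" for w
    using assms(2) by (simp add: minimizers_def is_arg_min_linorder)
  then have "blinfun_apply (gradient f z) = (\<lambda>_. 0)"
    using has_derivative_local_min[OF gradient_has_derivative[OF assms(1)]] by simp
  then show ?thesis by (simp add: blinfun_eqI)
qed

theorem theorem5p2:
  fixes B :: "'a::euclidean_space \<Rightarrow> ('a \<Rightarrow>\<^sub>L real)"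
    and f :: "'a \<Rightarrow> real"
    and L\<^sub>f :: real
    and x\<^sub>0 xstar :: 'a
    and y v :: "nat \<Rightarrow> 'a"
    and a A :: "nat \<Rightarrow> real"
  assumes "spd_operator B"
    and "convex_on UNIV f"
    and "\<And>x. f differentiable (at x)"
    and "L\<^sub>f > 0"
    and "\<And>x z. dual_norm B (gradient f x - gradient f z) \<le> L\<^sub>f * primal_norm B (x - z)"
    and "xstar \<in> minimizers f"
    and "y 0 = x\<^sub>0"
    and "v 0 = x\<^sub>0"
    and "\<And>k. a (Suc k) > 0"
    and "A 0 = 0"
    and "\<And>k. A (Suc k) = A k + a (Suc k)"
    and "\<And>k. v (Suc k) = v k - a (Suc k) *\<^sub>R inv B (gradient f (y (Suc k)))"
  shows "\<forall>k. gap_term B f L\<^sub>f xstar A y v k \<ge>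
    gap_term B f L\<^sub>f xstar A y v (Suc k)
    + (A (Suc k) / L\<^sub>f - (a (Suc k))\<^sup>2 / 2) * (dual_norm B (gradient f (y (Suc k))))\<^sup>2
    + \<langle>gradient f (y (Suc k)),
        A k *\<^sub>R (y k - (1 / L\<^sub>f) *\<^sub>R inv B (gradient f (y k)))
          + a (Suc k) *\<^sub>R v k - A (Suc k) *\<^sub>R y (Suc k)\<rangle>"
proof
  fix k
  note B = assms(1) and lip = assms(5)
  define g h where "g = gradient f (y (Suc k))" and "h = gradient f (y k)"
  have "A k \<ge> 0"
    by (induction k) (simp_all add: assms(10,11) add_nonneg_nonneg less_imp_le[OF assms(9)])
  have "f (y k) \<ge> f (y (Suc k)) + \<langle>g, y k - y (Suc k)\<rangle> + 1 / (2 * L\<^sub>f) * (dual_norm B (h - g))\<^sup>2"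
    unfolding g_def h_def by (rule convex_smooth_lower_bound[OF B assms(2-4) lip])
  then have y: "A k * f (y k) \<ge> A k * (f (y (Suc k)) + \<langle>g, y k - y (Suc k)\<rangle>
      + 1 / (2 * L\<^sub>f) * ((dual_norm B h)\<^sup>2 - 2 * \<langle>g, inv B h\<rangle> + (dual_norm B g)\<^sup>2))"
    using \<open>A k \<ge> 0\<close> by (intro mult_left_mono) (simp_all add: dual_norm_diff_sq[OF B])
  have "gradient f xstar = 0"
    by (rule gradient_minimizer[OF assms(3,6)])
  \<comment> \<open>With a vanishing gradient at \<open>xstar\<close>, the gradient difference is
    \<open>0 - g\<close>, whose dual norm is that of \<open>g\<close>.\<close>
  then have "f xstar \<ge> f (y (Suc k)) + \<langle>g, xstar - y (Suc k)\<rangle> + 1 / (2 * L\<^sub>f) * (dual_norm B g)\<^sup>2"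
    using convex_smooth_lower_bound[OF B assms(2-4) lip, of "y (Suc k)" xstar]
      dual_norm_diff_sq[OF B, of 0 g]
    by (simp add: g_def dual_norm_def linear_0[OF spd_operator_inv_linear[OF B]])
  then have x: "a (Suc k) * f xstar \<ge> a (Suc k) * (f (y (Suc k)) + \<langle>g, xstar - y (Suc k)\<rangle>
      + 1 / (2 * L\<^sub>f) * (dual_norm B g)\<^sup>2)"
    using assms(9)[of k] by (intro mult_left_mono) auto
  have v_eq: "v (Suc k) - xstar = (v k - xstar) - a (Suc k) *\<^sub>R inv B g"
    by (simp add: assms(12) g_def)
  \<comment> \<open>In the cross term \<open>B\<close> cancels \<open>inv B\<close>, which leaves
    the plain pairing with \<open>g\<close>.\<close>
  have v: "(primal_norm B (v (Suc k) - xstar))\<^sup>2 = (primal_norm B (v k - xstar))\<^sup>2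
      - 2 * a (Suc k) * \<langle>g, v k - xstar\<rangle> + (a (Suc k))\<^sup>2 * (dual_norm B g)\<^sup>2"
    by (simp add: v_eq primal_norm_diff_sq[OF B] primal_norm_scaleR[OF B]
        dual_norm_eq_primal_norm[OF B] linear_scale[OF spd_operator_linear[OF B]] B
        blinfun.scaleR_left power_mult_distrib)
  show "gap_term B f L\<^sub>f xstar A y v k \<ge>
    gap_term B f L\<^sub>f xstar A y v (Suc k)
    + (A (Suc k) / L\<^sub>f - (a (Suc k))\<^sup>2 / 2) * (dual_norm B (gradient f (y (Suc k))))\<^sup>2
    + \<langle>gradient f (y (Suc k)),
        A k *\<^sub>R (y k - (1 / L\<^sub>f) *\<^sub>R inv B (gradient f (y k)))
          + a (Suc k) *\<^sub>R v k - A (Suc k) *\<^sub>R y (Suc k)\<rangle>"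
    \<comment> \<open>In the sum of \<open>x\<close> and \<open>y\<close> the terms in
      \<open>h\<close> squared and in \<open>xstar\<close> cancel. The two inequalities give
      \<open>A (Suc k) / (2 * L\<^sub>f)\<close> times the square of \<open>dual_norm B g\<close>,
      and the gap term at \<open>Suc k\<close> gives as much again, hence the coefficient
      \<open>A (Suc k) / L\<^sub>f\<close>.\<close>
    using x y unfolding gap_term_def v assms(11) g_def[symmetric] h_def[symmetric]
    by (simp add: blinfun.add_right blinfun.diff_right blinfun.scaleR_right
        add_divide_distrib diff_divide_distrib algebra_simps)
qed

end
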